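(* Let $n>2$ be prime and $\zeta$ a primitive $n$-th root of unity, and consider the family of polynomial systems with parameters $a$ described in the context. For $\nu\in\mathbb{N}_0^{n\ell}$, the monomial $[\nu]$ is an invariant of the group $\mathbf{y}=e^{\mathcal{Z}\psi}\mathbf{x}$, $\psi\in\mathbb{C}$ (acting on the parameters of the system), if and only if $\nu\in\mathcal{M}^{(n)}$.
   Context: $\mathbb{N}_0=\{0,1,2,\dots\}$ and $\mathbb{N}_{-1}=\mathbb{N}_0\cup\{-1\}$. $\mathcal{Z}=\mathrm{diag}[1,\zeta,\dots,\zeta^{n-1}]$, $\bar\zeta=(1,\zeta,\dots,\zeta^{n-1})$. $T_n$ is the cyclic permutation $T_n(p_1,\dots,p_n)=(p_n,p_1,\dots,p_{n-1})$. Fix $\ell\ge1$ and distinct vectors $\mathbf{p}^{(1)},\dots,\mathbf{p}^{(\ell)}\in\mathbb{N}_{-1}\times\mathbb{N}_0^{n-1}$ with $\sum_jp_j^{(k)}\ge1$ for all $k$. For a vector $\mathbf{p}$ write $\mathbf{x}^{\mathbf{p}}=x_1^{p_1}\cdots x_n^{p_n}$. The system is $$\dot x_j=x_j\Big(\zeta^{j-1}+\sum_{k=1}^{\ell}a^{(j)}_{T_n^{j-1}(\mathbf{p}^{(k)})}\,\mathbf{x}^{T_n^{j-1}(\mathbf{p}^{(k)})}\Big),\qquad j=1,\dots,n,$$ with $n\ell$ independent complex parameters $a^{(j)}_{T_n^{j-1}(\mathbf{p}^{(k)})}$; $\mathbb{C}[a]$ is the polynomial ring in them. The change of coordinates $\mathbf{y}=e^{\mathcal{Z}\psi}\mathbf{x}$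 transforms the system into one of the same form in which each parameter $a^{(m+1)}_{T_n^m(\mathbf{p}^{(k)})}$ is replaced by $a^{(m+1)}_{T_n^m(\mathbf{p}^{(k)})}e^{-\psi\,T_n^m(\mathbf{p}^{(k)})\cdot\bar\zeta}$, where $\mathbf{p}\cdot\bar\zeta=\sum_ip_i\zeta^{i-1}$. This defines the action of the group on parameters; $f\in\mathbb{C}[a]$ is an invariant if it is unchanged by this substitution for every $\psi\in\mathbb{C}$. For $\nu\in\mathbb{N}_0^{n\ell}$: $[\nu]=\prod_{k=1}^{\ell}\prod_{m=0}^{n-1}\big(a^{(m+1)}_{T_n^m(\mathbf{p}^{(k)})}\big)^{\nu_{(k-1)n+m+1}}$ and $L(\nu)=\sum_{k=1}^{\ell}\sum_{m=0}^{n-1}\nu_{(k-1)n+m+1}\,T_n^m(\mathbf{p}^{(k)})\in\mathbb{Z}^n$. $\mathcal{M}^{(n)}=\{\nu\in\mathbb{N}_0^{n\ell}:L(\nu)=(K,\dots,K)\text{ for some }K\in\mathbb{N}_0\}$. *)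

theory Defs
  imports "HOL-Analysis.Analysis" "HOL-Library.Poly_Mapping"
    "HOL-Computational_Algebra.Primes"
begin

definition primitive_root_of_unity :: "nat \<Rightarrow> complex \<Rightarrow> bool" where
  "primitive_root_of_unity n \<zeta> \<longleftrightarrow>
     n > 0 \<and> \<zeta> ^ n = 1 \<and> (\<forall>m. 0 < m \<and> m < n \<longrightarrow> \<zeta> ^ m \<noteq> 1)"

text \<open>Exponent vectors are integer lists of length \<open>n\<close>.  All indices are 0-based: the entry
  \<open>p ! i\<close> is $p_{i+1}$, and equation number \<open>j\<close> is the one for $x_{j+1}$.\<close>

definition cyc :: "'a list \<Rightarrow> 'a list" where
  "cyc p = last p # butlast p"

definition exponent_vectors :: "nat \<Rightarrow> int list set" where
  "exponent_vectors n =
     {p. length p = n \<and> p ! 0 \<ge> - 1 \<and> (\<forall>i. 0 < i \<and> i < n \<longrightarrow> p ! i \<ge> 0)}"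

definition dot_zeta :: "complex \<Rightarrow> int list \<Rightarrow> complex" where
  "dot_zeta \<zeta> q = (\<Sum>i<length q. of_int (q ! i) * \<zeta> ^ i)"

text \<open>The name \<open>(m, q)\<close> stands for the parameter $a^{(m+1)}_q$.  If \<open>ps\<close> lists the distinct
  vectors $\mathbf p^{(1)},\dots,\mathbf p^{(\ell)}$, then \<open>par ps k m\<close> is the parameter
  $a^{(m+1)}_{T_n^m(\mathbf p^{(k+1)})}$.\<close>

type_synonym param = "nat \<times> int list"

definition par :: "int list list \<Rightarrow> nat \<Rightarrow> nat \<Rightarrow> param" where
  "par ps k m = (m, (cyc ^^ m) (ps ! k))"

definition params :: "nat \<Rightarrow> int list list \<Rightarrow> param set" where
  "params n ps = {par ps k m | k m. k < length ps \<and> m < n}"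

text \<open>The right-hand side of the equation for \<open>x j\<close>.  The factor $x_j$ is multiplied into the
  monomial, so that every exponent of a variable is nonnegative (the only entry of an exponent
  vector that may be \<open>-1\<close> is the one belonging to $x_j$) and the expression
  is polynomial also where \<open>x j = 0\<close>.\<close>

definition system_rhs ::
  "nat \<Rightarrow> complex \<Rightarrow> int list list \<Rightarrow> (param \<Rightarrow> complex) \<Rightarrow> (nat \<Rightarrow> complex) \<Rightarrow> nat \<Rightarrow> complex" where
  "system_rhs n \<zeta> ps a x j = \<zeta> ^ j * x j +
     (\<Sum>k<length ps. a (par ps k j) *
        (\<Prod>i<n. x i powi ((cyc ^^ j) (ps ! k) ! i + (if i = j then 1 else 0))))"

definition change_coords :: "complex \<Rightarrow> complex \<Rightarrow> (nat \<Rightarrow> complex) \<Rightarrow> (nat \<Rightarrow> complex)" where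
  "change_coords \<zeta> \<psi> x = (\<lambda>j. exp (\<psi> * \<zeta> ^ j) * x j)"

definition param_factor :: "complex \<Rightarrow> complex \<Rightarrow> param \<Rightarrow> complex" where
  "param_factor \<zeta> \<psi> v = exp (- \<psi> * dot_zeta \<zeta> (snd v))"

lemma length_cyc_pow: "p \<noteq> [] \<Longrightarrow> length ((cyc ^^ m) p) = length p"
proof (induction m)
  case (Suc m)
  then have "length ((cyc ^^ m) p) > 0" by simp
  with Suc show ?case by (simp add: cyc_def)
qed simp

text \<open>If \<open>x\<close> solves the system with parameters \<open>a\<close>, then \<open>y = change_coords \<zeta> \<psi> x\<close> has
  $\dot y_j = e^{\psi\zeta^j}\dot x_j$, so the following identity says that \<open>y\<close> solves the system
  with every parameter multiplied by its \<open>param_factor\<close>.\<close>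

lemma system_rhs_change_coords:
  assumes "\<forall>p\<in>set ps. length p = n" and "j < n"
  shows "system_rhs n \<zeta> ps (\<lambda>v. a v * param_factor \<zeta> \<psi> v) (change_coords \<zeta> \<psi> x) j =
         exp (\<psi> * \<zeta> ^ j) * system_rhs n \<zeta> ps a x j"
proof -
  have key: "a (par ps k j) * param_factor \<zeta> \<psi> (par ps k j) *
        (\<Prod>i<n. change_coords \<zeta> \<psi> x i powi ((cyc ^^ j) (ps ! k) ! i + (if i = j then 1 else 0))) =
      exp (\<psi> * \<zeta> ^ j) * (a (par ps k j) *
        (\<Prod>i<n. x i powi ((cyc ^^ j) (ps ! k) ! i + (if i = j then 1 else 0))))"
    if "k < length ps" for k
  proof -
    define q where "q = (cyc ^^ j) (ps ! k)"
    define e where "e i = q ! i + (if i = j then 1 else 0)" for i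
    have "length (ps ! k) = n" using assms(1) that by auto
    then have len: "length q = n"
      using assms(2) unfolding q_def by (subst length_cyc_pow) auto
    have "(\<Sum>i<n. of_int (e i) * (\<psi> * \<zeta> ^ i)) =
        (\<Sum>i<n. \<psi> * (of_int (q ! i) * \<zeta> ^ i) + (if i = j then \<psi> * \<zeta> ^ j else 0))"
      by (rule sum.cong) (auto simp: e_def algebra_simps)
    also have "\<dots> = \<psi> * dot_zeta \<zeta> q + \<psi> * \<zeta> ^ j"
      using assms(2) by (simp add: sum.distrib sum_distrib_left dot_zeta_def len)
    finally have s: "(\<Sum>i<n. of_int (e i) * (\<psi> * \<zeta> ^ i)) = \<psi> * dot_zeta \<zeta> q + \<psi> * \<zeta> ^ j" .
    have "(\<Prod>i<n. change_coords \<zeta> \<psi> x i powi e i) =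
        (\<Prod>i<n. exp (of_int (e i) * (\<psi> * \<zeta> ^ i))) * (\<Prod>i<n. x i powi e i)"
      unfolding prod.distrib[symmetric]
      by (rule prod.cong)
         (auto simp: change_coords_def power_int_mult_distrib exp_power_int)
    also have "(\<Prod>i<n. exp (of_int (e i) * (\<psi> * \<zeta> ^ i))) =
        exp (\<psi> * dot_zeta \<zeta> q) * exp (\<psi> * \<zeta> ^ j)"
      by (simp add: exp_sum[symmetric] s exp_add)
    finally have "param_factor \<zeta> \<psi> (par ps k j) * (\<Prod>i<n. change_coords \<zeta> \<psi> x i powi e i) =
        exp (\<psi> * \<zeta> ^ j) * (\<Prod>i<n. x i powi e i)"
      by (simp add: param_factor_def par_def q_def[symmetric] exp_minus)
    then show ?thesis
      by (simp add: e_def q_def mult.assoc mult.left_commute)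
  qed
  have "\<zeta> ^ j * change_coords \<zeta> \<psi> x j = exp (\<psi> * \<zeta> ^ j) * (\<zeta> ^ j * x j)"
    by (simp add: change_coords_def)
  moreover note sum.cong[OF refl key, of "{..<length ps}"]
  ultimately show ?thesis
    unfolding system_rhs_def distrib_left sum_distrib_left by simp
qed

text \<open>Polynomials over \<open>complex\<close> in variables named by \<open>param\<close>: finitely supported functions from
  power products to coefficients, with the ring structure of \<open>Poly_Mapping\<close>.\<close>

type_synonym param_poly = "(param \<Rightarrow>\<^sub>0 nat) \<Rightarrow>\<^sub>0 complex"

definition Const :: "complex \<Rightarrow> param_poly" where
  "Const c = Poly_Mapping.single 0 c"

definition Var :: "param \<Rightarrow> param_poly" where
  "Var v = Poly_Mapping.single (Poly_Mapping.single v 1) 1"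

definition poly_ring :: "param set \<Rightarrow> param_poly set" where
  "poly_ring V = {f. \<forall>t\<in>Poly_Mapping.keys f. Poly_Mapping.keys t \<subseteq> V}"

definition subst_poly :: "(param \<Rightarrow> param_poly) \<Rightarrow> param_poly \<Rightarrow> param_poly" where
  "subst_poly \<sigma> f = (\<Sum>t\<in>Poly_Mapping.keys f. Const (Poly_Mapping.lookup f t) *
     (\<Prod>v\<in>Poly_Mapping.keys t. \<sigma> v ^ Poly_Mapping.lookup t v))"

definition group_act :: "complex \<Rightarrow> complex \<Rightarrow> param_poly \<Rightarrow> param_poly" where
  "group_act \<zeta> \<psi> = subst_poly (\<lambda>v. Var v * Const (param_factor \<zeta> \<psi> v))"

definition is_invariant :: "nat \<Rightarrow> complex \<Rightarrow> int list list \<Rightarrow> param_poly \<Rightarrow> bool" where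
  "is_invariant n \<zeta> ps f \<longleftrightarrow> f \<in> poly_ring (params n ps) \<and> (\<forall>\<psi>. group_act \<zeta> \<psi> f = f)"

text \<open>Vectors $\nu\in\mathbb N_0^{n\ell}$ are lists of naturals of length \<open>n * length ps\<close>;
  with \<open>k\<close> and list positions counted from 0, $\nu_{(k-1)n+m+1}$ is \<open>\<nu> ! (k * n + m)\<close>.\<close>

definition mono_of :: "nat \<Rightarrow> int list list \<Rightarrow> nat list \<Rightarrow> param_poly" where
  "mono_of n ps \<nu> = (\<Prod>k<length ps. \<Prod>m<n. Var (par ps k m) ^ (\<nu> ! (k * n + m)))"

definition L :: "nat \<Rightarrow> int list list \<Rightarrow> nat list \<Rightarrow> int list" where
  "L n ps \<nu> = map (\<lambda>i. \<Sum>k<length ps. \<Sum>m<n.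
     int (\<nu> ! (k * n + m)) * (cyc ^^ m) (ps ! k) ! i) [0..<n]"

definition M :: "nat \<Rightarrow> int list list \<Rightarrow> nat list set" where
  "M n ps = {\<nu>. length \<nu> = n * length ps \<and> (\<exists>K::nat. L n ps \<nu> = replicate n (int K))}"

end

theory Submission
  imports Defs "HOL-Computational_Algebra.Polynomial"
begin

text \<open>The group multiplies each parameter by an exponential, so it multiplies the monomial $[\nu]$
  by $e^{-\psi w}$, where the weight is $w = L(\nu)\cdot\bar\zeta$
  (\<open>group_act_monomial\<close>, \<open>weight_exponents\<close>).  As $\psi$ ranges over all
  complex numbers, $[\nu]$ is fixed exactly when $w = 0$.  This is an integer relation
  $\sum_i c_i\zeta^i = 0$ with $c = L(\nu)$.  For prime order, the only such relations are the
  multiples of $1 + \zeta + \dots + \zeta^{n-1} = 0$ (\<open>sum_prime_root_eq_0_iff\<close>), so $w = 0$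
  means that $L(\nu) = (K,\dots,K)$ with an integer $K$.  Finally $K \ge 0$: the entries of $L(\nu)$
  add up to $nK$, and this total is a combination of the positive entry sums of the vectors
  $\mathbf p^{(k)}$ with the coefficients $\nu_i \ge 0$ (\<open>sum_list_L_nonneg\<close>).

  The arithmetic core is that an integer polynomial $f$ of degree below $p - 1$ that vanishes at a
  primitive $p$-th root of unity is zero (\<open>no_short_relation\<close>).  Its proof has two parts.
  A norm argument shows $p \mid f(1)$ for every integer polynomial with $f(\zeta) = 0$, that is,
  $p$ divides the constant term of every integer relation in powers of $\lambda = \zeta - 1$.
  The Eisenstein shape of the polynomial $((X+1)^p - 1)/X$, which has the root $\lambda$, says that
  $pV(\lambda) = -\lambda^{p-1}$ for an integer polynomial $V$ with $V(0) = 1$.  Hence in a relation in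
  powers of $\lambda$, after multiplication by $V(\lambda)$ the terms whose coefficients are divisible
  by $p$ can be traded for terms of high order; cancelling a power of $\lambda$ moves the next coefficient into constant position.  So all
  coefficients of a relation of degree below $p - 1$ are divisible by $p$, which is impossible for a
  primitive polynomial.\<close>

section \<open>Integer relations between roots of unity of prime order\<close>

definition int_eval :: "complex \<Rightarrow> int poly \<Rightarrow> complex" where
  "int_eval z f = poly (map_poly of_int f) z"

lemma int_eval_0 [simp]: "int_eval z 0 = 0"
  by (simp add: int_eval_def)

lemma int_eval_pCons [simp]: "int_eval z (pCons a f) = of_int a + z * int_eval z f"
  by (simp add: int_eval_def map_poly_pCons)

lemma int_eval_add [simp]: "int_eval z (f + g) = int_eval z f + int_eval z g"
proof (induction f arbitrary: g)
  case (pCons a f)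
  then show ?case by (cases g) (simp add: algebra_simps)
qed simp

lemma int_eval_smult [simp]: "int_eval z (smult c f) = of_int c * int_eval z f"
  by (induction f) (simp_all add: algebra_simps)

lemma int_eval_diff [simp]: "int_eval z (f - g) = int_eval z f - int_eval z g"
  using int_eval_add[of z "f - g" g] by simp

lemma int_eval_mult [simp]: "int_eval z (f * g) = int_eval z f * int_eval z g"
  by (induction f) (simp_all add: algebra_simps)

lemma int_eval_1 [simp]: "int_eval z 1 = 1"
  by (simp add: one_pCons)

lemma int_eval_sum [simp]: "int_eval z (sum f A) = (\<Sum>i\<in>A. int_eval z (f i))"
  by (induction A rule: infinite_finite_induct) simp_all

lemma int_eval_prod [simp]: "int_eval z (prod f A) = (\<Prod>i\<in>A. int_eval z (f i))"
  by (induction A rule: infinite_finite_induct) simp_all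

lemma int_eval_monom [simp]: "int_eval z (monom c k) = of_int c * z ^ k"
  by (induction k) (simp_all add: monom_0 monom_Suc)

lemma int_eval_pcompose [simp]: "int_eval z (pcompose f g) = int_eval (int_eval z g) f"
  by (induction f) (simp_all add: pcompose_pCons)

lemma int_eval_eq_sum: "int_eval z f = (\<Sum>i\<le>degree f. of_int (coeff f i) * z ^ i)"
  by (subst (1) poly_as_sum_of_monoms[of f, symmetric]) (simp only: int_eval_sum int_eval_monom)

lemma primitive_root_power_eq_1_iff:
  assumes "primitive_root_of_unity n \<zeta>"
  shows "\<zeta> ^ k = 1 \<longleftrightarrow> n dvd k"
proof -
  have n: "n > 0" "\<zeta> ^ n = 1" using assms by (auto simp: primitive_root_of_unity_def)
  have "\<zeta> ^ k = (\<zeta> ^ n) ^ (k div n) * \<zeta> ^ (k mod n)"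
    by (simp add: power_mult[symmetric] power_add[symmetric])
  then have "\<zeta> ^ k = \<zeta> ^ (k mod n)" using n by simp
  moreover have "\<zeta> ^ (k mod n) = 1 \<longleftrightarrow> k mod n = 0"
    using assms n(1) by (auto simp: primitive_root_of_unity_def)
  ultimately show ?thesis by (simp add: dvd_eq_mod_eq_0)
qed

lemma sum_powers_primitive_root:
  assumes "primitive_root_of_unity n \<zeta>"
  shows "(\<Sum>a<n. (\<zeta> ^ a) ^ i) = (if n dvd i then of_nat n else 0)"
proof -
  have eq: "(\<zeta> ^ a) ^ i = (\<zeta> ^ i) ^ a" for a
    by (simp add: power_mult[symmetric] mult.commute)
  show ?thesis
  proof (cases "n dvd i")
    case True
    then show ?thesis
      using primitive_root_power_eq_1_iff[OF assms, of i] by (simp add: eq)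
  next
    case False
    then have "\<zeta> ^ i \<noteq> 1" using primitive_root_power_eq_1_iff[OF assms] by simp
    moreover have "(\<zeta> ^ i) ^ n = 1"
      using primitive_root_power_eq_1_iff[OF assms, of "i * n"] by (simp add: power_mult)
    ultimately show ?thesis using False by (simp add: eq geometric_sum)
  qed
qed

text \<open>Let $G(X) = \prod_{j=1}^{p-1} f(X^j)$.  Each $\zeta^a$ with $p \nmid a$ is a root of $G$,
  because $f(\zeta^{aj}) = f(\zeta) = 0$ for a $j$ chosen with $aj \equiv 1$ modulo $p$.
  So the sum of $G$ over all $p$-th roots of unity is $G(1) = f(1)^{p-1}$; on the other hand, by orthogonality it is $p$ times the sum of the
  coefficients of $G$ at the multiples of $p$.\<close>

lemma prime_dvd_poly_1_of_root:
  assumes p: "prime p" and \<zeta>: "primitive_root_of_unity p \<zeta>" and f: "int_eval \<zeta> f = 0"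
  shows "int p dvd poly f 1"
proof -
  define G where "G = (\<Prod>j=1..<p. pcompose f (monom 1 j))"
  have G0: "int_eval (\<zeta> ^ a) G = 0" if a: "a \<in> {..<p} - {0}" for a
  proof -
    have "\<not> p dvd a" using a by (auto dest: dvd_imp_le)
    then have "gcd a p = 1"
      using p by (metis coprime_commute coprime_iff_gcd_eq_1 prime_imp_coprime)
    then obtain x y where xy: "a * x = p * y + 1"
      using a bezout_nat[of a p] by auto
    define j where "j = x mod p"
    have p1: "p > 1" using p prime_gt_1_nat by simp
    have "j \<noteq> 0"
    proof
      assume "j = 0"
      then have "p dvd a * x" by (simp add: j_def dvd_eq_mod_eq_0[symmetric])
      then have "p dvd p * y + 1" by (simp only: xy)
      then have "p dvd 1" by (metis dvd_add_right_iff dvd_triv_left)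
      then show False using p1 by simp
    qed
    then have j: "j \<in> {1..<p}" using p1 by (simp add: j_def)
    have per: "\<zeta> ^ (p * k) = 1" for k
      using primitive_root_power_eq_1_iff[OF \<zeta>] by simp
    have "\<zeta> = \<zeta> ^ (a * x)" unfolding xy by (simp add: power_add per)
    also have "a * x = p * (a * (x div p)) + a * j"
      unfolding j_def by (metis distrib_left mult.left_commute mult_div_mod_eq)
    also have "\<zeta> ^ \<dots> = (\<zeta> ^ a) ^ j" by (simp only: power_add per power_mult[symmetric]) simp
    finally have "(\<zeta> ^ a) ^ j = \<zeta>" by simp
    then show ?thesis using j f by (auto simp: G_def intro!: prod_zero bexI[of _ j])
  qed
  have "(\<Sum>a<p. int_eval (\<zeta> ^ a) G) = int_eval (\<zeta> ^ 0) G"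
    using G0 p by (subst sum.remove[of _ 0]) (auto simp: prime_gt_0_nat)
  also have "\<dots> = of_int (poly G 1)"
    by (simp add: int_eval_eq_sum poly_altdef)
  also have "(\<Sum>a<p. int_eval (\<zeta> ^ a) G) =
      (\<Sum>i\<le>degree G. of_int (coeff G i) * (\<Sum>a<p. (\<zeta> ^ a) ^ i))"
    unfolding int_eval_eq_sum sum_distrib_left by (rule sum.swap)
  also have "\<dots> = of_int (int p * (\<Sum>i\<le>degree G. if p dvd i then coeff G i else 0))"
    unfolding sum_powers_primitive_root[OF \<zeta>] of_int_mult of_int_sum sum_distrib_left
    by (rule sum.cong) auto
  finally have "int p dvd poly G 1" by (metis dvd_triv_left of_int_eq_iff)
  also have "poly G 1 = poly f 1 ^ (p - 1)"
    by (simp add: G_def poly_prod poly_pcompose poly_monom)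
  finally show ?thesis using p by (meson prime_dvd_power prime_nat_int_transfer)
qed

lemma prime_dvd_coeff_0_of_root:
  assumes "prime p" and "primitive_root_of_unity p \<zeta>" and "int_eval (\<zeta> - 1) h = 0"
  shows "int p dvd coeff h 0"
  using prime_dvd_poly_1_of_root[OF assms(1,2), of "pcompose h [:-1, 1:]"] assms(3)
  by (simp add: poly_pcompose poly_0_coeff_0)

text \<open>Expanding $1 = (1 + \lambda)^p$ with $\lambda = \zeta - 1$ and dividing by $\lambda$ gives
  $0 = \lambda^{p-1} + \sum_{k<p-1}\binom{p}{k+1}\lambda^k$.  All these binomial coefficients are
  divisible by $p$, and for $k = 0$ the quotient is $1$.\<close>

lemma prime_root_minus_1_eisenstein:
  assumes p: "prime p" and \<zeta>: "primitive_root_of_unity p \<zeta>"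
  obtains V where "coeff V 0 = 1" and "of_nat p * int_eval (\<zeta> - 1) V = - ((\<zeta> - 1) ^ (p - 1))"
proof -
  have p1: "p > 1" using p prime_gt_1_nat by simp
  define V where "V = (\<Sum>k<p-1. monom (int ((p choose Suc k) div p)) k)"
  have ne: "\<zeta> - 1 \<noteq> 0"
    using primitive_root_power_eq_1_iff[OF \<zeta>, of 1] p1 by auto
  have "coeff V 0 = (\<Sum>k<p-1. if k = 0 then int ((p choose Suc k) div p) else 0)"
    by (simp add: V_def coeff_sum)
  also have "\<dots> = 1" using p1 by simp
  finally have V0: "coeff V 0 = 1" .
  have pdvd: "of_nat p * complex_of_int (int ((p choose Suc k) div p)) = of_nat (p choose Suc k)"
    if "k < p - 1" for k
  proof -
    have "p dvd (p choose Suc k)" using p that by (intro dvd_choose_prime) auto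
    then show ?thesis by (metis dvd_mult_div_cancel of_int_of_nat_eq of_nat_mult)
  qed
  have "1 = ((\<zeta> - 1) + 1) ^ p"
    using primitive_root_power_eq_1_iff[OF \<zeta>, of p] by simp
  also have "\<dots> = (\<Sum>k\<le>p. of_nat (p choose k) * (\<zeta> - 1) ^ k)"
    by (subst binomial_ring) simp
  also have "\<dots> = 1 + ((\<zeta> - 1) ^ p +
      (\<Sum>k<p-1. of_nat (p choose Suc k) * (\<zeta> - 1) ^ Suc k))"
  proof (cases p)
    case (Suc q)
    show ?thesis
      unfolding Suc by (subst sum.atMost_Suc_shift)
        (simp add: lessThan_Suc_atMost[symmetric] del: binomial_Suc_Suc)
  qed (use p1 in simp)
  also have "(\<zeta> - 1) ^ p = (\<zeta> - 1) * (\<zeta> - 1) ^ (p - 1)"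
    using p1 by (cases p) simp_all
  also have "(\<Sum>k<p-1. of_nat (p choose Suc k) * (\<zeta> - 1) ^ Suc k) =
      (\<zeta> - 1) * (of_nat p * int_eval (\<zeta> - 1) V)"
    unfolding V_def int_eval_sum int_eval_monom sum_distrib_left
    by (rule sum.cong) (simp_all only: pdvd[symmetric] lessThan_iff power_Suc mult_ac)
  finally have "(\<zeta> - 1) * ((\<zeta> - 1) ^ (p - 1) + of_nat p * int_eval (\<zeta> - 1) V) = 0"
    by (simp add: distrib_left)
  then have "of_nat p * int_eval (\<zeta> - 1) V = - ((\<zeta> - 1) ^ (p - 1))"
    using ne by (simp add: eq_neg_iff_add_eq_0 add.commute)
  then show ?thesis using that V0 by blast
qed

text \<open>Suppose that $p$ divides $b_j$ for all $j < i$.  After multiplication of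
  $\sum_j b_j\lambda^j = 0$ by $V(\lambda)$, the terms with $j < i$ become
  $(b_j/p)\,\lambda^j\,pV(\lambda) = -(b_j/p)\,\lambda^{p-1+j}$.  As $i < p - 1$, a factor
  $\lambda^i$ cancels and these terms still have positive order, so the constant term of the new
  relation is $b_i V(0) = b_i$.\<close>

lemma prime_dvd_coeffs_of_root:
  assumes p: "prime p" and \<zeta>: "primitive_root_of_unity p \<zeta>"
    and b: "int_eval (\<zeta> - 1) b = 0" and "i < p - 1"
  shows "int p dvd coeff b i"
  using \<open>i < p - 1\<close>
proof (induction i rule: less_induct)
  case (less i)
  define z where "z = \<zeta> - 1"
  obtain V where V0: "coeff V 0 = 1" and V: "of_nat p * int_eval z V = - (z ^ (p - 1))"
    using prime_root_minus_1_eisenstein[OF p \<zeta>] unfolding z_def by blast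
  have p1: "p > 1" using p prime_gt_1_nat by simp
  have ne: "z \<noteq> 0"
    using primitive_root_power_eq_1_iff[OF \<zeta>, of 1] p1 by (auto simp: z_def)
  define R where "R = poly_shift i b"
  have b_split: "b = (\<Sum>j<i. monom (coeff b j) j) + monom 1 i * R"
    by (rule poly_eqI)
       (auto simp: coeff_sum coeff_monom_mult R_def coeff_poly_shift if_distrib sum.delta' not_less
             cong: if_cong)
  \<comment> \<open>the relation \<open>b * V\<close> at \<open>z\<close>, with its low terms traded, divided by \<open>z ^ i\<close>\<close>
  define h where "h = R * V - (\<Sum>j<i. monom (coeff b j div int p) (p - 1 + j - i))"
  have low: "of_int (coeff b j) * z ^ j * int_eval z V =
      - (z ^ i * (of_int (coeff b j div int p) * z ^ (p - 1 + j - i)))" if "j < i" for j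
  proof -
    have "int p dvd coeff b j" using less that by simp
    then have "complex_of_int (coeff b j) = of_int (coeff b j div int p) * of_nat p"
      by (metis dvd_div_mult_self of_int_mult of_int_of_nat_eq)
    then have "of_int (coeff b j) * z ^ j * int_eval z V =
        of_int (coeff b j div int p) * z ^ j * (of_nat p * int_eval z V)" by simp
    also have "\<dots> = - (of_int (coeff b j div int p) * z ^ (p - 1 + j))"
      by (simp add: V power_add mult_ac)
    also have "z ^ (p - 1 + j) = z ^ i * z ^ (p - 1 + j - i)"
      using less.prems by (simp add: power_add[symmetric])
    finally show ?thesis by (simp add: mult_ac)
  qed
  have "0 = int_eval z b * int_eval z V" using b by (simp add: z_def)
  also have "\<dots> = (\<Sum>j<i. of_int (coeff b j) * z ^ j * int_eval z V) +
      z ^ i * (int_eval z R * int_eval z V)"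
    by (subst b_split) (simp add: algebra_simps sum_distrib_right sum_distrib_left)
  also have "(\<Sum>j<i. of_int (coeff b j) * z ^ j * int_eval z V) =
      - (z ^ i * (\<Sum>j<i. of_int (coeff b j div int p) * z ^ (p - 1 + j - i)))"
    by (simp add: low sum_negf sum_distrib_left)
  finally have "z ^ i * (int_eval z R * int_eval z V -
      (\<Sum>j<i. of_int (coeff b j div int p) * z ^ (p - 1 + j - i))) = 0"
    unfolding right_diff_distrib by (metis add.commute add_uminus_conv_diff)
  then have "z ^ i * int_eval z h = 0" by (simp add: h_def)
  then have "int_eval (\<zeta> - 1) h = 0" using ne by (simp add: z_def)
  then have "int p dvd coeff h 0" by (rule prime_dvd_coeff_0_of_root[OF p \<zeta>])
  moreover have "coeff h 0 = coeff b i"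
    using less.prems V0
    by (auto simp: h_def coeff_sum coeff_mult_0 R_def coeff_poly_shift intro!: sum.neutral)
  ultimately show ?case by simp
qed

text \<open>The substitution $X \mapsto X + 1$ turns $f$ into a relation of the same degree in powers of
  $\zeta - 1$, and dividing by the content makes it primitive.\<close>

lemma no_short_relation:
  assumes p: "prime p" and \<zeta>: "primitive_root_of_unity p \<zeta>"
    and f: "int_eval \<zeta> f = 0" and deg: "degree f < p - 1"
  shows "f = 0"
proof (rule ccontr)
  assume "f \<noteq> 0"
  define b where "b = pcompose f [:1, 1:]"
  have "b \<noteq> 0" using \<open>f \<noteq> 0\<close> by (simp add: b_def pcompose_eq_0_iff)
  then have c: "content b \<noteq> 0" by simp
  have b0: "int_eval (\<zeta> - 1) b = 0" using f by (simp add: b_def)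
  then have "of_int (content b) * int_eval (\<zeta> - 1) (primitive_part b) = 0"
    by (metis content_times_primitive_part int_eval_smult)
  then have root: "int_eval (\<zeta> - 1) (primitive_part b) = 0" using c by simp
  have "int p dvd coeff (primitive_part b) i" for i
  proof (cases "i < p - 1")
    case True
    then show ?thesis by (rule prime_dvd_coeffs_of_root[OF p \<zeta> root])
  next
    case False
    then have "degree (primitive_part b) < i" using deg by (simp add: b_def degree_pcompose)
    then show ?thesis by (simp add: coeff_eq_0)
  qed
  then have "int p dvd content (primitive_part b)"
    by (simp add: const_poly_dvd_iff_dvd_content[symmetric] const_poly_dvd_iff)
  then have "int p dvd 1" using \<open>b \<noteq> 0\<close> by simp
  then show False using p by (simp add: prime_nat_iff)
qed

text \<open>Subtracting $c_{p-1}(1 + \zeta + \dots + \zeta^{p-1}) = 0$ removes the last term and leaves a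
  relation of degree at most $p - 2$.\<close>

lemma sum_prime_root_eq_0_iff:
  fixes c :: "nat \<Rightarrow> int"
  assumes p: "prime p" and \<zeta>: "primitive_root_of_unity p \<zeta>"
  shows "(\<Sum>i<p. of_int (c i) * \<zeta> ^ i) = 0 \<longleftrightarrow> (\<forall>i<p. c i = c (p - 1))"
proof -
  have p1: "p > 1" using p prime_gt_1_nat by simp
  have sum0: "(\<Sum>i<p. \<zeta> ^ i) = 0"
    using sum_powers_primitive_root[OF \<zeta>, of 1] p1 by simp
  define f where "f = (\<Sum>i<p-1. monom (c i - c (p - 1)) i)"
  have "(\<Sum>i<p. of_int (c i) * \<zeta> ^ i) =
      (\<Sum>i<p. of_int (c i) * \<zeta> ^ i) - of_int (c (p - 1)) * (\<Sum>i<p. \<zeta> ^ i)"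
    by (simp add: sum0)
  also have "\<dots> = (\<Sum>i<p. of_int (c i - c (p - 1)) * \<zeta> ^ i)"
    by (simp add: sum_distrib_left sum_subtractf left_diff_distrib)
  also have "\<dots> = int_eval \<zeta> f"
    using p1 by (cases p) (simp_all add: f_def)
  finally have ev: "(\<Sum>i<p. of_int (c i) * \<zeta> ^ i) = int_eval \<zeta> f" .
  have "degree f \<le> p - 2"
    unfolding f_def by (rule degree_sum_le) (auto intro: order_trans[OF degree_monom_le])
  then have "int_eval \<zeta> f = 0 \<longleftrightarrow> f = 0"
    using no_short_relation[OF p \<zeta>, of f] p1 by (cases "p = 2") auto
  also have "\<dots> \<longleftrightarrow> (\<forall>i<p-1. c i = c (p - 1))"
    by (auto simp: poly_eq_iff f_def coeff_sum)
  also have "\<dots> \<longleftrightarrow> (\<forall>i<p. c i = c (p - 1))"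
    using p1 by (metis One_nat_def Suc_pred less_Suc_eq less_trans zero_less_one)
  finally show ?thesis by (simp add: ev)
qed

section \<open>The action on monomials\<close>

text \<open>The linear extension to exponents of the rates $\mathbf q\cdot\bar\zeta$ at which the group
  scales the single parameters.\<close>

definition weight :: "complex \<Rightarrow> (param \<Rightarrow>\<^sub>0 nat) \<Rightarrow> complex" where
  "weight \<zeta> t = (\<Sum>v\<in>Poly_Mapping.keys t. of_nat (Poly_Mapping.lookup t v) * dot_zeta \<zeta> (snd v))"

lemma weight_superset:
  assumes "finite A" "Poly_Mapping.keys t \<subseteq> A"
  shows "weight \<zeta> t = (\<Sum>v\<in>A. of_nat (Poly_Mapping.lookup t v) * dot_zeta \<zeta> (snd v))"
  unfolding weight_def using assms by (intro sum.mono_neutral_left) (auto simp: in_keys_iff)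

lemma weight_0 [simp]: "weight \<zeta> 0 = 0"
  by (simp add: weight_def)

lemma weight_add: "weight \<zeta> (s + t) = weight \<zeta> s + weight \<zeta> t"
proof -
  let ?A = "Poly_Mapping.keys s \<union> Poly_Mapping.keys t"
  have "Poly_Mapping.keys (s + t) \<subseteq> ?A" by (rule Poly_Mapping.keys_add)
  then show ?thesis
    by (simp add: weight_superset[of ?A] lookup_add distrib_right sum.distrib)
qed

lemma weight_sum: "weight \<zeta> (sum t A) = (\<Sum>i\<in>A. weight \<zeta> (t i))"
  by (induction A rule: infinite_finite_induct) (simp_all add: weight_add)

lemma weight_single: "weight \<zeta> (Poly_Mapping.single v e) = of_nat e * dot_zeta \<zeta> (snd v)"
  by (simp add: weight_def)

lemma Var_power: "Var v ^ e = Poly_Mapping.single (Poly_Mapping.single v e) 1"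
  by (induction e) (simp_all add: Var_def mult_single single_add[symmetric] flip: single_one)

lemma prod_single:
  "(\<Prod>i\<in>A. Poly_Mapping.single (t i) (c i)) =
    (Poly_Mapping.single (sum t A) (prod c A) :: param_poly)"
  by (induction A rule: infinite_finite_induct) (simp_all add: mult_single)

lemma sum_single_lookup:
  "(\<Sum>v\<in>Poly_Mapping.keys t. Poly_Mapping.single v (Poly_Mapping.lookup t v)) = t"
  by (rule poly_mapping_eqI) (simp add: lookup_sum lookup_single when_def in_keys_iff)

lemma group_act_monomial:
  "group_act \<zeta> \<psi> (Poly_Mapping.single t 1) = Poly_Mapping.single t (exp (- \<psi> * weight \<zeta> t))"
proof -
  have "(Var v * Const (param_factor \<zeta> \<psi> v)) ^ e =
      Poly_Mapping.single (Poly_Mapping.single v e) (param_factor \<zeta> \<psi> v ^ e)" for v e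
  proof -
    have "Const c ^ e = Const (c ^ e)" for c
      by (induction e) (simp_all add: Const_def mult_single)
    then show ?thesis
      by (simp add: power_mult_distrib Var_power) (simp add: Const_def mult_single)
  qed
  then have "group_act \<zeta> \<psi> (Poly_Mapping.single t 1) =
      (\<Prod>v\<in>Poly_Mapping.keys t. Poly_Mapping.single
        (Poly_Mapping.single v (Poly_Mapping.lookup t v))
        (param_factor \<zeta> \<psi> v ^ Poly_Mapping.lookup t v))"
    by (simp add: group_act_def subst_poly_def Const_def)
  also have "\<dots> = Poly_Mapping.single t
      (\<Prod>v\<in>Poly_Mapping.keys t. param_factor \<zeta> \<psi> v ^ Poly_Mapping.lookup t v)"
    by (simp add: prod_single sum_single_lookup)
  also have "(\<Prod>v\<in>Poly_Mapping.keys t. param_factor \<zeta> \<psi> v ^ Poly_Mapping.lookup t v) =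
      exp (- \<psi> * weight \<zeta> t)"
    by (simp add: param_factor_def weight_def exp_of_nat_mult[symmetric] exp_sum[symmetric]
        sum_distrib_left sum_negf mult_ac)
  finally show ?thesis .
qed

text \<open>If the weight $w$ is nonzero, then $\psi = -1/w$ scales the monomial by $e \ne 1$.\<close>

lemma monomial_fixed_iff_weight_eq_0:
  "(\<forall>\<psi>. group_act \<zeta> \<psi> (Poly_Mapping.single t 1) = Poly_Mapping.single t 1) \<longleftrightarrow> weight \<zeta> t = 0"
proof
  assume inv: "\<forall>\<psi>. group_act \<zeta> \<psi> (Poly_Mapping.single t 1) = Poly_Mapping.single t 1"
  show "weight \<zeta> t = 0"
  proof (rule ccontr)
    assume "weight \<zeta> t \<noteq> 0"
    moreover have "exp (- (- 1 / weight \<zeta> t) * weight \<zeta> t) = 1"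
      using inv[rule_format, of "- 1 / weight \<zeta> t"] unfolding group_act_monomial
      by (metis lookup_single_eq)
    ultimately have "exp (1::complex) = 1" by simp
    then have "exp (1::real) = 1" by (metis exp_of_real of_real_1 of_real_eq_iff)
    then show False by simp
  qed
qed (simp add: group_act_monomial)

definition exponents :: "nat \<Rightarrow> int list list \<Rightarrow> nat list \<Rightarrow> (param \<Rightarrow>\<^sub>0 nat)" where
  "exponents n ps \<nu> =
     (\<Sum>k<length ps. \<Sum>m<n. Poly_Mapping.single (par ps k m) (\<nu> ! (k * n + m)))"

lemma mono_of_eq_single: "mono_of n ps \<nu> = Poly_Mapping.single (exponents n ps \<nu>) 1"
  by (simp add: mono_of_def Var_power prod_single exponents_def)

lemma mono_of_in_poly_ring: "mono_of n ps \<nu> \<in> poly_ring (params n ps)"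
proof -
  have "v \<in> params n ps" if "v \<in> Poly_Mapping.keys (exponents n ps \<nu>)" for v
  proof -
    have "Poly_Mapping.lookup (exponents n ps \<nu>) v \<noteq> 0" using that by (simp add: in_keys_iff)
    then obtain k where k: "k < length ps"
      "(\<Sum>m<n. Poly_Mapping.lookup (Poly_Mapping.single (par ps k m) (\<nu> ! (k * n + m))) v) \<noteq> 0"
      unfolding exponents_def lookup_sum
      by (metis (no_types, lifting) lessThan_iff sum.not_neutral_contains_not_neutral)
    then obtain m where "m < n" "par ps k m = v"
      by (metis (no_types, lifting) lessThan_iff sum.not_neutral_contains_not_neutral
          lookup_single_not_eq)
    then show ?thesis using k(1) by (auto simp: params_def)
  qed
  then show ?thesis by (auto simp: poly_ring_def mono_of_eq_single)
qed

lemma weight_exponents: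
  assumes "\<And>p. p \<in> set ps \<Longrightarrow> length p = n"
  shows "weight \<zeta> (exponents n ps \<nu>) = (\<Sum>i<n. of_int (L n ps \<nu> ! i) * \<zeta> ^ i)"
proof -
  have len: "length ((cyc ^^ m) (ps ! k)) = n" if "k < length ps" "m < n" for k m
    using that assms[of "ps ! k"] by (subst length_cyc_pow) auto
  have "weight \<zeta> (exponents n ps \<nu>) = (\<Sum>k<length ps. \<Sum>m<n. \<Sum>i<n.
      of_nat (\<nu> ! (k * n + m)) * (of_int ((cyc ^^ m) (ps ! k) ! i) * \<zeta> ^ i))"
    unfolding exponents_def weight_sum weight_single
    by (intro sum.cong) (auto simp: par_def dot_zeta_def len sum_distrib_left)
  also have "\<dots> = (\<Sum>k<length ps. \<Sum>i<n. \<Sum>m<n.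
      of_nat (\<nu> ! (k * n + m)) * (of_int ((cyc ^^ m) (ps ! k) ! i) * \<zeta> ^ i))"
    by (intro sum.cong refl sum.swap)
  also have "\<dots> = (\<Sum>i<n. \<Sum>k<length ps. \<Sum>m<n.
      of_nat (\<nu> ! (k * n + m)) * (of_int ((cyc ^^ m) (ps ! k) ! i) * \<zeta> ^ i))"
    by (rule sum.swap)
  also have "\<dots> = (\<Sum>i<n. of_int (L n ps \<nu> ! i) * \<zeta> ^ i)"
    by (simp add: L_def sum_distrib_right mult.assoc)
  finally show ?thesis .
qed

section \<open>The sign of the common entry\<close>

lemma sum_list_cyc_pow: "p \<noteq> [] \<Longrightarrow> sum_list ((cyc ^^ m) p) = (sum_list p :: int)"
proof (induction m)
  case (Suc m)
  have "(cyc ^^ m) p \<noteq> []" using length_cyc_pow[OF Suc.prems, of m] Suc.prems by auto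
  then have "sum_list (cyc ((cyc ^^ m) p)) = sum_list ((cyc ^^ m) p)"
    by (metis add.commute append_butlast_last_id cyc_def sum_list.Cons sum_list.Nil
        sum_list.append add_0_right)
  then show ?case using Suc by simp
qed simp

text \<open>Cyclic shifts preserve the entry sum, so the entries of $L(\nu)$ add up to
  $\sum_{k,m}\nu_{(k-1)n+m+1}\sum_j p^{(k)}_j$.\<close>

lemma sum_list_L_nonneg:
  assumes "n > 0" and len: "\<And>p. p \<in> set ps \<Longrightarrow> length p = n"
    and pos: "\<And>p. p \<in> set ps \<Longrightarrow> sum_list p \<ge> 0"
  shows "sum_list (L n ps \<nu>) \<ge> 0"
proof -
  have "sum_list (L n ps \<nu>) = (\<Sum>i<n. \<Sum>k<length ps. \<Sum>m<n.
     int (\<nu> ! (k * n + m)) * (cyc ^^ m) (ps ! k) ! i)"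
    by (simp add: L_def interv_sum_list_conv_sum_set_nat atLeast0LessThan)
  also have "\<dots> = (\<Sum>k<length ps. \<Sum>i<n. \<Sum>m<n.
     int (\<nu> ! (k * n + m)) * (cyc ^^ m) (ps ! k) ! i)"
    by (rule sum.swap)
  also have "\<dots> = (\<Sum>k<length ps. \<Sum>m<n. \<Sum>i<n.
     int (\<nu> ! (k * n + m)) * (cyc ^^ m) (ps ! k) ! i)"
    by (intro sum.cong refl sum.swap)
  also have "\<dots> \<ge> 0"
  proof (rule sum_nonneg, rule sum_nonneg)
    fix k m assume "k \<in> {..<length ps}" "m \<in> {..<n}"
    then have k: "ps ! k \<in> set ps" by simp
    have ne: "ps ! k \<noteq> []" using len[OF k] \<open>n > 0\<close> by auto
    have "(\<Sum>i<n. (cyc ^^ m) (ps ! k) ! i) = sum_list ((cyc ^^ m) (ps ! k))"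
      using length_cyc_pow[OF ne, of m] len[OF k] by (simp add: sum_list_sum_nth atLeast0LessThan)
    also have "\<dots> \<ge> 0" using pos[OF k] by (simp add: sum_list_cyc_pow[OF ne])
    finally show "(\<Sum>i<n. int (\<nu> ! (k * n + m)) * (cyc ^^ m) (ps ! k) ! i) \<ge> 0"
      by (simp add: sum_distrib_left[symmetric])
  qed
  finally show ?thesis .
qed

section \<open>The invariant monomials\<close>

theorem theorem4p2:
  fixes n l :: nat and \<zeta> :: complex and ps :: "int list list" and \<nu> :: "nat list"
  assumes "prime n" and "n > 2"
    and "primitive_root_of_unity n \<zeta>"
    and "l \<ge> 1" and "length ps = l" and "distinct ps"
    and "\<And>p. p \<in> set ps \<Longrightarrow> p \<in> exponent_vectors n"
    and "\<And>p. p \<in> set ps \<Longrightarrow> sum_list p \<ge> 1"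
    and "length \<nu> = n * l"
  shows "is_invariant n \<zeta> ps (mono_of n ps \<nu>) \<longleftrightarrow> \<nu> \<in> M n ps"
proof -
  have len: "length p = n" if "p \<in> set ps" for p
    using assms(7)[OF that] by (simp add: exponent_vectors_def)
  have lenL: "length (L n ps \<nu>) = n" by (simp add: L_def)
  have "is_invariant n \<zeta> ps (mono_of n ps \<nu>) \<longleftrightarrow> weight \<zeta> (exponents n ps \<nu>) = 0"
    using mono_of_in_poly_ring[of n ps \<nu>] monomial_fixed_iff_weight_eq_0
    by (simp add: is_invariant_def mono_of_eq_single)
  also have "\<dots> \<longleftrightarrow> (\<Sum>i<n. of_int (L n ps \<nu> ! i) * \<zeta> ^ i) = 0"
    using weight_exponents[OF len] by simp
  also have "\<dots> \<longleftrightarrow> (\<forall>i<n. L n ps \<nu> ! i = L n ps \<nu> ! (n - 1))"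
    by (rule sum_prime_root_eq_0_iff[OF assms(1,3)])
  also have "\<dots> \<longleftrightarrow> (\<exists>K. L n ps \<nu> = replicate n K)"
    using lenL assms(2) by (auto simp: list_eq_iff_nth_eq)
  also have "\<dots> \<longleftrightarrow> (\<exists>K::nat. L n ps \<nu> = replicate n (int K))"
  proof
    assume "\<exists>K. L n ps \<nu> = replicate n K"
    then obtain K where K: "L n ps \<nu> = replicate n K" by blast
    have "sum_list (L n ps \<nu>) \<ge> 0"
      using assms(2,8) by (intro sum_list_L_nonneg len) force+
    then have "K \<ge> 0" using assms(2) by (simp add: K sum_list_replicate zero_le_mult_iff)
    then show "\<exists>K::nat. L n ps \<nu> = replicate n (int K)" using K by (metis zero_le_imp_eq_int)
  qed blast
  also have "\<dots> \<longleftrightarrow> \<nu> \<in> M n ps" using assms(5,9) by (simp add: M_def)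
  finally show ?thesis .
qed

end
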